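(* For every constant $c\ge 4$, there is a set $\mathcal{P}_c=\{P^m\}_{m\in\mathbb{N}}$ of simple $c$-chains in the Euclidean plane $\mathbb{R}^2$ such that, for every $m\in\mathbb{N}$, the chain $P^m$ has $n=4^m+1$ vertices and stretch factor $$\delta_{P^m}=(n-1)^{\frac{1+\log(c-2)-\log c}{2}},$$ where $\log$ denotes the logarithm in base $2$.
   Context: A polygonal chain $P=(p_1,\dots,p_n)$ in $\mathbb{R}^2$ is specified by a sequence of $n$ points $p_1,\dots,p_n$, called its vertices; it consists of the $n-1$ line segments between consecutive vertices. $P$ is simple if only consecutive line segments intersect and they only intersect at their endpoints. $|pq|$ denotes the Euclidean distance between $p$ and $q$. For a real number $c\ge 1$, $P$ is called a $c$-chain if $|p_ip_j|+|p_jp_k|\le c\,|p_ip_k|$ for all $1\le i<j<k\le n$. The stretch factor of $P$ is $$\delta_P=\frac{\sum_{i=1}^{n-1}|p_ip_{i+1}|}{|p_1p_n|}.$$ Here $\mathbb{N}=\{0,1,2,\dots\}$. *)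

theory Defs
  imports "HOL-Analysis.Analysis"
begin

text \<open>A polygonal chain is the list of its vertices. Indices start at 0, so the vertex
  \<open>p\<^sub>i\<close> of the mathematical notation is \<open>P ! (i - 1)\<close>.\<close>

type_synonym chain = "(real^2) list"

definition chain_edge :: "chain \<Rightarrow> nat \<Rightarrow> (real^2) set" where
  "chain_edge P i = closed_segment (P ! i) (P ! Suc i)"

text \<open>The first conjunct excludes edges that are a single point; the other two say that
  consecutive edges meet only at their common vertex and all other pairs are disjoint.\<close>

definition simple_chain :: "chain \<Rightarrow> bool" where
  "simple_chain P \<longleftrightarrow>
     (\<forall>i. Suc i < length P \<longrightarrow> P ! i \<noteq> P ! Suc i) \<and>
     (\<forall>i. Suc (Suc i) < length P \<longrightarrow>
        chain_edge P i \<inter> chain_edge P (Suc i) = {P ! Suc i}) \<and>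
     (\<forall>i j. Suc i < j \<and> Suc j < length P \<longrightarrow>
        chain_edge P i \<inter> chain_edge P j = {})"

definition c_chain :: "real \<Rightarrow> chain \<Rightarrow> bool" where
  "c_chain c P \<longleftrightarrow>
     (\<forall>i j k. i < j \<and> j < k \<and> k < length P \<longrightarrow>
        dist (P ! i) (P ! j) + dist (P ! j) (P ! k) \<le> c * dist (P ! i) (P ! k))"

definition stretch_factor :: "chain \<Rightarrow> real" where
  "stretch_factor P =
     (\<Sum>i<length P - 1. dist (P ! i) (P ! Suc i)) / dist (hd P) (last P)"

end

theory Submission
  imports Defs
begin

text \<open>
  The chains are Koch-type curves. Put \<open>a = (c - 2) / (2c)\<close>, so that \<open>1/4 \<le> a < 1/2\<close> and
  \<open>c = 2 / (1 - 2a)\<close>, and let \<open>Q\<close> be the apex of the isosceles triangle \<open>T\<close> over \<open>[0, 1]\<close> with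
  legs of length \<open>\<surd>a\<close>. Replacing a segment by four segments of relative length \<open>a\<close>
  multiplies the length by \<open>4a = 2(c - 2)/c\<close>. This replacement is two rounds of a simpler one:
  the maps \<open>gL\<close> and \<open>gR\<close> are orientation-reversing similarities of ratio \<open>\<surd>a\<close> taking \<open>T\<close> into
  itself and \<open>[0, 1]\<close> onto the legs \<open>[0, Q]\<close> and \<open>[Q, 1]\<close>. So one can induct on two pieces, and only
  triples \<open>x, z, y\<close> with \<open>x\<close> in the left and \<open>y\<close> in the right piece need work.

  The pieces meet only in \<open>Q\<close>, at an angle that gives
  \<open>(1 - 2a)(|xQ| + |Qy|) \<le> 2a|xy|\<close>. If \<open>z\<close> is in the left piece, then \<open>|xz| \<le> |xQ|\<close>, because
  on a copy of the curve no vertex after \<open>x\<close> is farther from \<open>x\<close> than the end of that copy. Hence \<open>|xz| + |zy| \<le> 2|xQ| + |xy|\<close>, which is at most \<open>c|xy|\<close> since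
  \<open>2a \<le> 1\<close>.
\<close>

section \<open>Convexity of norms and linear functionals\<close>

lemma convex_on_norm_affine:
  fixes f :: "'a::real_vector \<Rightarrow> 'b::real_normed_vector"
  assumes "linear f"
  shows "convex_on UNIV (\<lambda>x. norm (b + f x))"
proof (rule convex_onI)
  fix t x y assume t: "(0::real) < t" "t < 1"
  have "b + f ((1 - t) *\<^sub>R x + t *\<^sub>R y) = (1 - t) *\<^sub>R (b + f x) + t *\<^sub>R (b + f y)"
    using assms by (simp add: linear_add linear_diff linear_scale algebra_simps)
  then show "norm (b + f ((1 - t) *\<^sub>R x + t *\<^sub>R y)) \<le> (1 - t) * norm (b + f x) + t * norm (b + f y)"
    using t norm_triangle_ineq[of "(1 - t) *\<^sub>R (b + f x)" "t *\<^sub>R (b + f y)"] by simp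
qed auto

lemma convex_on_real_linear:
  fixes f :: "'a::real_vector \<Rightarrow> real"
  assumes "linear f"
  shows "convex_on UNIV f"
  using assms by (auto intro!: convex_onI simp: linear_add linear_scale)

section \<open>The two similarities and the curve they generate\<close>

text \<open>The norm bound makes the angle between the legs obtuse or straight, and
  \<open>1 - 2 * a\<close> positive.\<close>

locale koch =
  fixes Q :: complex
  assumes Re_Q: "Re Q = 1/2" and norm_Q: "(cmod Q)\<^sup>2 < 1/2"
begin

definition a :: real where "a = (cmod Q)\<^sup>2"

definition gL :: "complex \<Rightarrow> complex" where "gL z = Q * cnj z"
definition gR :: "complex \<Rightarrow> complex" where "gR z = Q + cnj Q * cnj z"

fun vertex :: "nat \<Rightarrow> nat \<Rightarrow> complex" where
  "vertex 0 i = (if i = 0 then 0 else 1)"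
| "vertex (Suc k) i = (if i \<le> 2 ^ k then gL (vertex k i) else gR (vertex k (i - 2 ^ k)))"

definition edge :: "nat \<Rightarrow> nat \<Rightarrow> complex set" where
  "edge k i = closed_segment (vertex k i) (vertex k (Suc i))"

definition T :: "complex set" where "T = convex hull {0, 1, Q}"

lemma a_eq: "a = 1/4 + (Im Q)\<^sup>2"
  unfolding a_def cmod_power2 Re_Q by (simp add: power2_eq_square)

lemma a_bounds: "1/4 \<le> a" "a < 1/2"
  using a_eq norm_Q a_def by auto

lemma cmod_Q: "1/2 \<le> cmod Q" "Q \<noteq> 0"
  using Re_Q abs_Re_le_cmod[of Q] by auto

lemma Q_mult_cnj: "Q * cnj Q = of_real a"
  unfolding a_def by (rule complex_norm_square[symmetric])

lemma cnj_Q: "cnj Q = 1 - Q"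
  using Re_Q by (simp add: complex_eq_iff)

lemma linear_gL: "linear gL"
  by (rule linearI) (auto simp: gL_def algebra_simps scaleR_conv_of_real)

lemma linear_gR_part: "linear (\<lambda>z. cnj Q * cnj z)"
  by (rule linearI) (auto simp: algebra_simps scaleR_conv_of_real)

lemma gL_simps: "gL 0 = 0" "gL 1 = Q" "gL Q = of_real a"
  using Q_mult_cnj by (auto simp: gL_def)

lemma gR_simps: "gR 0 = Q" "gR 1 = 1"
  by (auto simp: gR_def cnj_Q)

lemma dist_gL: "dist (gL x) (gL y) = cmod Q * dist x y"
proof -
  have "gL x - gL y = Q * cnj (x - y)" by (simp add: gL_def algebra_simps)
  then show ?thesis by (simp add: dist_norm norm_mult del: complex_cnj_diff)
qed

lemma dist_gR: "dist (gR x) (gR y) = cmod Q * dist x y"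
proof -
  have "gR x - gR y = cnj Q * cnj (x - y)" by (simp add: gR_def algebra_simps)
  then show ?thesis by (simp add: dist_norm norm_mult del: complex_cnj_diff)
qed

lemma inj_gL: "gL x = gL y \<Longrightarrow> x = y" and inj_gR: "gR x = gR y \<Longrightarrow> x = y"
  using cmod_Q by (auto simp: gL_def gR_def)

lemma vertex_0 [simp]: "vertex k 0 = 0"
  by (induction k) (auto simp: gL_simps)

lemma vertex_last [simp]: "vertex k (2 ^ k) = 1"
  by (induction k) (auto simp: gR_simps)

lemma vertex_left: "i \<le> 2 ^ k \<Longrightarrow> vertex (Suc k) i = gL (vertex k i)"
  by simp

text \<open>At the joint, \<open>i = 0\<close>, both maps give \<open>Q\<close>, so no case
  distinction remains.\<close>

lemma vertex_right: "vertex (Suc k) (2 ^ k + i) = gR (vertex k i)"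
  by (auto simp: gL_simps gR_simps)

declare vertex.simps(2) [simp del]

text \<open>The map \<open>1 - cnj z\<close> reflects in the line \<open>Re z = 1/2\<close>, which
  swaps the legs. Facts about one piece thus carry over to the other.\<close>

lemma gR_refl: "gR (1 - cnj z) = 1 - cnj (gL z)"
  by (simp add: gR_def gL_def algebra_simps) (simp add: cnj_Q)

lemma gL_refl: "gL (1 - cnj z) = 1 - cnj (gR z)"
  by (simp add: gR_def gL_def algebra_simps) (simp add: cnj_Q)

lemma vertex_refl: "i \<le> 2 ^ k \<Longrightarrow> vertex k (2 ^ k - i) = 1 - cnj (vertex k i)"
proof (induction k arbitrary: i)
  case 0
  then show ?case by auto
next
  case (Suc k)
  show ?case
  proof (cases "i \<le> 2 ^ k")
    case True
    then have "2 ^ Suc k - i = 2 ^ k + (2 ^ k - i)" by simp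
    then have "vertex (Suc k) (2 ^ Suc k - i) = gR (vertex k (2 ^ k - i))"
      by (simp only: vertex_right)
    then show ?thesis using True Suc.IH[of i] by (simp add: vertex_left gR_refl)
  next
    case False
    define j where "j = i - 2 ^ k"
    have j: "i = 2 ^ k + j" "j \<le> 2 ^ k" "2 ^ Suc k - i = 2 ^ k - j"
      using False Suc.prems by (auto simp: j_def)
    have "vertex (Suc k) (2 ^ Suc k - i) = gL (vertex k (2 ^ k - j))"
      unfolding j(3) by (simp add: vertex_left)
    then show ?thesis using j Suc.IH[of j] by (simp add: vertex_right gL_refl)
  qed
qed

section \<open>The triangle \<open>T\<close> and its invariance\<close>

lemma T_vertices: "0 \<in> T" "1 \<in> T" "Q \<in> T"
  by (auto simp: T_def hull_inc)

lemma convex_T: "convex T"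
  by (simp add: T_def)

text \<open>A convex function on a triangle is largest at a corner, so estimates over
  \<open>T\<close> reduce to three checks.\<close>

lemma T_bound:
  assumes "convex_on UNIV f" "f 0 \<le> b" "f 1 \<le> b" "f Q \<le> b" "z \<in> T"
  shows "f z \<le> b"
proof -
  have "convex_on (convex hull {0, 1, Q}) f"
    using convex_on_subset[OF assms(1)] by simp
  then show ?thesis
    using convex_on_convex_hull_bound[of "{0, 1, Q}" f b] assms(2-5) unfolding T_def by blast
qed

lemma real_in_T: "0 \<le> r \<Longrightarrow> r \<le> 1 \<Longrightarrow> of_real r \<in> T"
  using convexD[OF convex_T T_vertices(1,2), of "1 - r" r] by (simp add: scaleR_conv_of_real)

text \<open>The corners go to \<open>0\<close>, \<open>Q\<close> and the point \<open>a\<close> of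
  the base; convexity does the rest.\<close>

lemma gL_T: "z \<in> T \<Longrightarrow> gL z \<in> T"
proof -
  have "T \<subseteq> gL -` T"
    unfolding T_def
    by (rule hull_minimal)
      (use T_vertices real_in_T[of a] a_bounds in
        \<open>auto simp: gL_simps T_def[symmetric] intro!: convex_linear_vimage linear_gL convex_T\<close>)
  then show "z \<in> T \<Longrightarrow> gL z \<in> T" by auto
qed

lemma refl_T: "z \<in> T \<Longrightarrow> 1 - cnj z \<in> T"
proof -
  \<comment> \<open>The reflection is only affine, so its preimage of \<open>T\<close> is expressed
    by the linear map \<open>- cnj z\<close> and the translate of \<open>T\<close> by
    \<open>-1\<close>.\<close>
  have "convex ((\<lambda>z. - cnj z) -` ((+) (-1) ` T))"
    by (intro convex_linear_vimage convex_translation convex_T linearI) auto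
  moreover have "(\<lambda>z. - cnj z) -` ((+) (-1) ` T) = {z. 1 - cnj z \<in> T}"
  proof -
    have "- cnj z = -1 + x \<longleftrightarrow> x = 1 - cnj z" for x z
      by (auto simp: algebra_simps)
    then show ?thesis by (auto simp: image_iff)
  qed
  ultimately have "T \<subseteq> {z. 1 - cnj z \<in> T}"
    using T_vertices unfolding T_def by (intro hull_minimal) (auto simp: cnj_Q)
  then show "z \<in> T \<Longrightarrow> 1 - cnj z \<in> T" by auto
qed

lemma gR_T: "z \<in> T \<Longrightarrow> gR z \<in> T"
  using refl_T[OF gL_T[OF refl_T[of z]]] gR_refl[of "1 - cnj z"] by simp

lemma vertex_in_T: "i \<le> 2 ^ k \<Longrightarrow> vertex k i \<in> T"
proof (induction k arbitrary: i)
  case 0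
  then show ?case by (auto simp: T_vertices)
next
  case (Suc k)
  then show ?case by (auto simp: vertex.simps intro!: gL_T gR_T)
qed

section \<open>Distance estimates for the two pieces\<close>

text \<open>Seen from \<open>Q\<close>, the left piece stays in a cone pointing away from the
  bisector. By convexity the corners suffice: \<open>z = 1\<close> and \<open>z = Q\<close> give
  equality, and \<open>z = 0\<close> follows from \<open>1 - 2 * a\<close> \<le> \<open>1/2\<close>
  \<le> \<open>cmod Q\<close>.\<close>

lemma separation_L:
  assumes "z \<in> T"
  shows "(1 - 2 * a) * dist (gL z) Q \<le> 2 * a * (1/2 - Re (gL z))"
proof -
  have Q_vertex: "dist (gL Q) Q = a"
  proof -
    have "gL Q - Q = - (Q * Q)" unfolding gL_def cnj_Q by (simp add: algebra_simps)
    then show ?thesis by (simp add: dist_norm norm_mult a_def power2_eq_square)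
  qed
  have zero_vertex: "(1 - 2 * a) * cmod Q \<le> a"
  proof -
    have "(1 - 2 * a) * cmod Q \<le> cmod Q * cmod Q"
      using a_bounds cmod_Q(1) by (intro mult_right_mono) auto
    then show ?thesis by (simp add: a_def power2_eq_square)
  qed
  have convex: "convex_on UNIV (\<lambda>z. (1 - 2 * a) * dist (gL z) Q + 2 * a * Re (gL z))"
  proof (intro convex_on_add convex_on_cmul)
    show "convex_on UNIV (\<lambda>z. dist (gL z) Q)"
      using convex_on_norm_affine[OF linear_gL, of "-Q"] by (simp add: dist_norm)
    show "convex_on UNIV (\<lambda>z. Re (gL z))"
      by (rule convex_on_real_linear, rule linearI)
        (auto simp: linear_add[OF linear_gL] linear_scale[OF linear_gL])
  qed (use a_bounds in auto)
  have "(1 - 2 * a) * dist (gL z) Q + 2 * a * Re (gL z) \<le> a"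
    by (rule T_bound[OF convex _ _ _ assms])
      (use Q_vertex zero_vertex in \<open>auto simp: gL_simps Re_Q algebra_simps\<close>)
  then show ?thesis by (simp add: algebra_simps)
qed

lemma separation_R:
  assumes "z \<in> T"
  shows "(1 - 2 * a) * dist (gR z) Q \<le> 2 * a * (Re (gR z) - 1/2)"
proof -
  have "gL (1 - cnj z) - Q = - cnj (gR z - Q)" by (simp add: gL_refl cnj_Q)
  then have "dist (gL (1 - cnj z)) Q = dist (gR z) Q"
    unfolding dist_norm by (metis complex_mod_cnj norm_minus_cancel)
  then show ?thesis
    using separation_L[OF refl_T[OF assms]] by (simp add: gL_refl)
qed

lemma Re_gL: "z \<in> T \<Longrightarrow> Re (gL z) \<le> 1/2" and Re_gR: "z \<in> T \<Longrightarrow> Re (gR z) \<ge> 1/2"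
proof -
  have *: "0 \<le> x" if "(1 - 2 * a) * dist p q \<le> 2 * a * x" for x and p q :: complex
  proof -
    have "0 \<le> (1 - 2 * a) * dist p q" using a_bounds by simp
    then have "0 \<le> 2 * a * x" using that by linarith
    then show ?thesis using a_bounds by (simp add: zero_le_mult_iff)
  qed
  show "z \<in> T \<Longrightarrow> Re (gL z) \<le> 1/2" using *[OF separation_L] by simp
  show "z \<in> T \<Longrightarrow> Re (gR z) \<ge> 1/2" using *[OF separation_R] by simp
qed

text \<open>Adding the two cone bounds leaves the difference of the real parts on the right, which
  is at most the distance.\<close>

lemma dist_gL_gR:
  assumes "x \<in> T" "y \<in> T"
  shows "(1 - 2 * a) * (dist (gL x) Q + dist (gR y) Q) \<le> 2 * a * dist (gL x) (gR y)"
proof -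
  have "Re (gR y) - Re (gL x) \<le> dist (gL x) (gR y)"
    using abs_Re_le_cmod[of "gR y - gL x"] by (simp add: dist_norm norm_minus_commute)
  then have "2 * a * (Re (gR y) - Re (gL x)) \<le> 2 * a * dist (gL x) (gR y)"
    using a_bounds by (intro mult_left_mono) auto
  then show ?thesis
    using separation_L[OF assms(1)] separation_R[OF assms(2)] by (simp add: algebra_simps)
qed

lemma gL_eq_gR:
  assumes "x \<in> T" "y \<in> T" "gL x = gR y"
  shows "x = 1" "y = 0"
proof -
  have "(1 - 2 * a) * (dist (gL x) Q + dist (gR y) Q) \<le> 0"
    using dist_gL_gR[OF assms(1,2)] assms(3) by simp
  then have "dist (gL x) Q + dist (gR y) Q \<le> 0"
    using a_bounds by (simp add: mult_le_0_iff)
  then have "gL x = Q" "gR y = Q"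
    by (metis add_le_same_cancel1 add_nonneg_eq_0_iff dist_eq_0_iff order_antisym zero_le_dist add_nonneg_nonneg)+
  then show "x = 1" "y = 0"
    using inj_gL[of x 1] inj_gR[of y 0] by (auto simp: gL_simps gR_simps)
qed

text \<open>The distance to \<open>gR w\<close> is convex, so \<open>z\<close> may be taken to be a corner of \<open>T\<close>. The claim then
  says that \<open>gR w\<close> lies in a fixed half-plane, which is checked with \<open>w\<close> at the corners.\<close>
lemma dist_le_norm_gR:
  assumes "w \<in> T" "z \<in> T"
  shows "dist (gR w) z \<le> cmod (gR w)"
proof -
  have lin: "linear (\<lambda>w. - Re (Q * Q * w))"
    by (rule linearI) (auto simp: algebra_simps)
  \<comment> \<open>\<open>Q\<close> is a root of \<open>x * x - x + a\<close>, so its powers become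
    affine in \<open>Q\<close>, with real parts known from \<open>Re Q = 1/2\<close>.\<close>
  have QQ: "Q * Q = Q - of_real a"
    using Q_mult_cnj unfolding cnj_Q by (simp add: algebra_simps)
  have QQQ: "Q * Q * Q = (1 - of_real a) * Q - of_real a"
    unfolding QQ using QQ by (simp add: algebra_simps)
  have "- Re (Q * Q * 1) \<le> a / 2" "- Re (Q * Q * Q) \<le> a / 2"
    unfolding QQQ unfolding mult_1_right QQ using a_bounds by (simp_all add: Re_Q algebra_simps)
  then have "- Re (Q * Q * w) \<le> a / 2"
    using a_bounds by (intro T_bound[OF convex_on_real_linear[OF lin] _ _ _ assms(1)]) simp_all
  moreover have "Re (gR w * cnj Q) = a + Re (Q * Q * w)"
  proof -
    have "gR w * cnj Q = Q * cnj Q + cnj (Q * Q * w)" by (simp add: gR_def algebra_simps)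
    then show ?thesis by (simp add: Q_mult_cnj)
  qed
  ultimately have 1: "Re (gR w * cnj Q) \<ge> a / 2" by linarith
  have *: "dist y u \<le> cmod y" if "(cmod u)\<^sup>2 \<le> 2 * Re (y * cnj u)" for y u
  proof -
    have "(dist y u)\<^sup>2 = (cmod y)\<^sup>2 + (cmod u)\<^sup>2 - 2 * Re (y * cnj u)"
      unfolding dist_norm cmod_power2 by (simp add: power2_eq_square algebra_simps)
    then have "(dist y u)\<^sup>2 \<le> (cmod y)\<^sup>2" using that by simp
    then show ?thesis by (rule power2_le_imp_le) simp
  qed
  have "convex_on UNIV (\<lambda>z. dist (gR w) z)"
    by (intro convex_on_dist convex_UNIV)
  then show ?thesis
    by (rule T_bound[OF _ _ _ _ assms(2)])
      (use 1 Re_gR[OF assms(1)] in \<open>auto intro!: * simp: a_def[symmetric] simp del: complex_cnj_mult times_complex.sel\<close>)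
qed

section \<open>Distances along the curve and the chain condition\<close>

text \<open>If vertex \<open>j\<close> is in the left piece, so is \<open>i\<close>, and
  \<open>gL\<close> fixes \<open>0\<close> and scales distances. If \<open>j\<close> is in the right
  piece, the bound over all of \<open>T\<close> applies.\<close>

lemma dist_vertex_le_first:
  "i \<le> j \<Longrightarrow> j \<le> 2 ^ k \<Longrightarrow> dist (vertex k j) (vertex k i) \<le> dist (vertex k j) 0"
proof (induction k arbitrary: i j)
  case 0
  then show ?case by auto
next
  case (Suc k)
  show ?case
  proof (cases "j \<le> 2 ^ k")
    case True
    then have "dist (vertex k j) (vertex k i) \<le> dist (vertex k j) 0" using Suc by blast
    then have "dist (gL (vertex k j)) (gL (vertex k i)) \<le> dist (gL (vertex k j)) (gL 0)"
      unfolding dist_gL by (intro mult_left_mono) auto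
    then show ?thesis using True Suc.prems by (simp add: vertex_left gL_simps)
  next
    case False
    then have "vertex (Suc k) j = gR (vertex k (j - 2 ^ k))" "vertex k (j - 2 ^ k) \<in> T"
      using Suc.prems by (auto simp: vertex.simps intro!: vertex_in_T)
    moreover have "vertex (Suc k) i \<in> T" using Suc.prems by (intro vertex_in_T) auto
    ultimately show ?thesis using dist_le_norm_gR by (simp add: dist_norm)
  qed
qed

text \<open>The reflection runs the curve backwards and swaps its ends, so the bound for the first
  vertex applies.\<close>

lemma dist_vertex_le_last:
  assumes "i \<le> j" "j \<le> 2 ^ k"
  shows "dist (vertex k i) (vertex k j) \<le> dist (vertex k i) 1"
proof -
  have r: "dist (1 - cnj x) (1 - cnj y) = dist x y" for x y
  proof -
    have "(1 - cnj x) - (1 - cnj y) = - cnj (x - y)" by simp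
    then show ?thesis unfolding dist_norm by (metis complex_mod_cnj norm_minus_cancel)
  qed
  have "dist (vertex k (2^k - i)) (vertex k (2^k - j)) \<le> dist (vertex k (2^k - i)) 0"
    using assms by (intro dist_vertex_le_first) auto
  then show ?thesis
    using assms r[of "vertex k i" "vertex k j"] r[of "vertex k i" 1] by (simp add: vertex_refl)
qed

lemma vertex_chain:
  "i \<le> j \<Longrightarrow> j \<le> l \<Longrightarrow> l \<le> 2 ^ k \<Longrightarrow>
    (1 - 2 * a) * (dist (vertex k i) (vertex k j) + dist (vertex k j) (vertex k l))
      \<le> 2 * dist (vertex k i) (vertex k l)"
proof (induction k arbitrary: i j l)
  case 0
  then show ?case using a_bounds by auto
next
  case (Suc k)
  have scale: "(1 - 2 * a) * (q * x + q * y) \<le> 2 * (q * z)"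
    if "(1 - 2 * a) * (x + y) \<le> 2 * z" "q \<ge> 0" for q x y z :: real
    using mult_left_mono[OF that] by (simp add: algebra_simps)
  consider "l \<le> 2 ^ k" | "2 ^ k \<le> i" | "i \<le> 2 ^ k" "2 ^ k \<le> l" by linarith
  then show ?case
  proof cases
    case 1
    then show ?thesis
      using Suc.IH[of i j l] Suc.prems by (simp add: vertex_left dist_gL scale)
  next
    case 2
    then obtain i' j' l' where eq: "i = 2^k + i'" "j = 2^k + j'" "l = 2^k + l'"
      using Suc.prems by (metis le_Suc_ex order_trans)
    then show ?thesis
      using Suc.IH[of i' j' l'] Suc.prems by (simp add: vertex_right dist_gR scale)
  next
    case 3
    let ?v = "vertex (Suc k)"
    obtain l' where l': "l = 2^k + l'" "l' \<le> 2^k"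
      using 3 Suc.prems by (metis le_Suc_ex nat_add_left_cancel_le power_Suc mult_2)
    have sep: "(1 - 2 * a) * (dist (?v i) Q + dist (?v l) Q) \<le> 2 * a * dist (?v i) (?v l)"
      using dist_gL_gR[of "vertex k i" "vertex k l'"] l' 3
      by (simp add: vertex_left vertex_right vertex_in_T)
    have *: ?thesis if close: "dist (?v i) (?v j) \<le> dist (?v i) Q \<or> dist (?v j) (?v l) \<le> dist (?v l) Q"
    proof -
      let ?d = "dist (?v i) (?v l)"
      \<comment> \<open>\<open>r\<close> is the one of the two distances bounded by
        \<open>close\<close>; the triangle inequality bounds the other by
        \<open>r + ?d\<close>.\<close>
      obtain r where r: "r \<le> dist (?v i) Q + dist (?v l) Q"
        and le: "dist (?v i) (?v j) + dist (?v j) (?v l) \<le> 2 * r + ?d"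
        using close
      proof
        assume True: "dist (?v i) (?v j) \<le> dist (?v i) Q"
        have "dist (?v j) (?v l) \<le> dist (?v i) (?v j) + ?d"
          by (metis dist_triangle3)
        then show ?thesis using True by (intro that[of "dist (?v i) (?v j)"]) (auto simp: add_increasing2)
      next
        assume "dist (?v j) (?v l) \<le> dist (?v l) Q"
        moreover have "dist (?v i) (?v j) \<le> ?d + dist (?v j) (?v l)"
          by (metis dist_triangle2)
        ultimately show ?thesis by (intro that[of "dist (?v j) (?v l)"]) (auto simp: add_increasing)
      qed
      have "(1 - 2 * a) * (dist (?v i) (?v j) + dist (?v j) (?v l)) \<le> (1 - 2 * a) * (2 * r + ?d)"
        using le a_bounds by (intro mult_left_mono) auto
      also have "\<dots> = 2 * ((1 - 2 * a) * r) + (1 - 2 * a) * ?d" by (simp add: algebra_simps)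
      also have "(1 - 2 * a) * r \<le> (1 - 2 * a) * (dist (?v i) Q + dist (?v l) Q)"
        using r a_bounds by (intro mult_left_mono) auto
      also note sep
      also have "2 * (2 * a * ?d) + (1 - 2 * a) * ?d = (1 + 2 * a) * ?d" by (simp add: algebra_simps)
      also have "\<dots> \<le> 2 * ?d" using a_bounds by (intro mult_right_mono) auto
      finally show ?thesis by simp
    qed
    \<comment> \<open>\<open>Q\<close> ends the left piece and starts the right one, so the scaled
      bounds for last and first vertex give \<open>close\<close>.\<close>
    show ?thesis
    proof (cases "j \<le> 2 ^ k")
      case True
      then have "dist (gL (vertex k i)) (gL (vertex k j)) \<le> dist (gL (vertex k i)) (gL 1)"
        unfolding dist_gL using Suc.prems by (intro mult_left_mono dist_vertex_le_last) auto
      then show ?thesis using * True 3 by (simp add: vertex_left gL_simps)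
    next
      case False
      then obtain j' where j': "j = 2^k + j'" by (metis le_Suc_ex nat_le_linear)
      then have "dist (gR (vertex k l')) (gR (vertex k j')) \<le> dist (gR (vertex k l')) (gR 0)"
        unfolding dist_gR using Suc.prems l' by (intro mult_left_mono dist_vertex_le_first) auto
      then show ?thesis using * j' l' by (simp add: vertex_right gR_simps dist_commute)
    qed
  qed
qed

section \<open>Lengths and intersections of the edges\<close>

lemma dist_vertex_Suc: "i < 2 ^ k \<Longrightarrow> dist (vertex k i) (vertex k (Suc i)) = cmod Q ^ k"
proof (induction k arbitrary: i)
  case 0
  then show ?case by simp
next
  case (Suc k)
  show ?case
  proof (cases "i < 2 ^ k")
    case True
    then show ?thesis using Suc.IH[of i] by (simp add: vertex_left dist_gL)
  next
    case False
    then obtain j where j: "i = 2 ^ k + j" by (metis le_Suc_ex not_less)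
    then have "vertex (Suc k) i = gR (vertex k j)" "vertex (Suc k) (Suc i) = gR (vertex k (Suc j))"
      using vertex_right[of k "Suc j"] by (simp_all only: vertex_right add_Suc_right)
    then show ?thesis
      using Suc.IH[of j] Suc.prems j by (simp add: dist_gR)
  qed
qed

lemma edge_subset_T: "i < 2 ^ k \<Longrightarrow> edge k i \<subseteq> T"
  unfolding edge_def by (intro closed_segment_subset vertex_in_T convex_T) auto

lemma edge_left: "i < 2 ^ k \<Longrightarrow> edge (Suc k) i = gL ` edge k i"
  unfolding edge_def by (simp add: vertex_left closed_segment_linear_image linear_gL)

lemma edge_right: "edge (Suc k) (2 ^ k + i) = gR ` edge k i"
proof -
  have "gR ` closed_segment x y = closed_segment (gR x) (gR y)" for x y
  proof -
    have "gR ` S = (+) Q ` (\<lambda>z. cnj Q * cnj z) ` S" for S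
      by (auto simp: gR_def image_iff)
    then show ?thesis
      unfolding closed_segment_linear_image[OF linear_gR_part, symmetric]
      by (simp add: closed_segment_translation closed_segment_linear_image[OF linear_gR_part] gR_def)
  qed
  then show ?thesis
    unfolding edge_def by (metis add_Suc_right vertex_right)
qed

lemma edge_cases:
  assumes "i < 2 ^ Suc k"
  obtains "i < 2 ^ k" "edge (Suc k) i = gL ` edge k i"
  | i' where "i = 2 ^ k + i'" "i' < 2 ^ k" "edge (Suc k) i = gR ` edge k i'"
proof (cases "i < 2 ^ k")
  case False
  then obtain i' where "i = 2 ^ k + i'" by (metis le_Suc_ex not_less)
  then show ?thesis using that(2)[of i'] assms edge_right by auto
qed (use edge_left that in blast)

text \<open>The left piece has real parts at most 1/2, so \<open>1\<close> can lie only on a right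
  edge, where it is \<open>gR 1\<close> and induction applies.\<close>

lemma last_in_edge: "i < 2 ^ k \<Longrightarrow> 1 \<in> edge k i \<Longrightarrow> Suc i = 2 ^ k"
proof (induction k arbitrary: i)
  case 0
  then show ?case by simp
next
  case (Suc k)
  from Suc.prems(1) show ?case
  proof (cases rule: edge_cases)
    case 1
    then obtain z where z: "z \<in> T" "1 = gL z"
      using Suc.prems edge_subset_T by blast
    then have "Re 1 \<le> 1/2" using Re_gL[of z] by (metis (no_types))
    then show ?thesis by simp
  next
    case (2 i')
    then have "1 \<in> edge k i'" using Suc.prems inj_gR gR_simps by (metis imageE)
    then show ?thesis using Suc.IH[of i'] 2 by simp
  qed
qed

lemma first_in_edge: "i < 2 ^ k \<Longrightarrow> 0 \<in> edge k i \<Longrightarrow> i = 0"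
proof (induction k arbitrary: i)
  case 0
  then show ?case by simp
next
  case (Suc k)
  from Suc.prems(1) show ?case
  proof (cases rule: edge_cases)
    case 1
    then have "0 \<in> edge k i" using Suc.prems inj_gL gL_simps by (metis imageE)
    then show ?thesis using Suc.IH[of i] 1 by simp
  next
    case (2 i')
    then obtain z where z: "z \<in> T" "0 = gR z"
      using Suc.prems edge_subset_T by blast
    then have "Re 0 \<ge> 1/2" using Re_gR[of z] by (metis (no_types))
    then show ?thesis by simp
  qed
qed

text \<open>Within one piece, injectivity reduces to the induction hypothesis. Across pieces the
  common point is \<open>Q\<close>, that is \<open>gL 1\<close> and \<open>gR 0\<close>, which only
  the last left and the first right edge contain.\<close>

lemma edges_meet:
  "i < j \<Longrightarrow> j < 2 ^ k \<Longrightarrow> z \<in> edge k i \<Longrightarrow> z \<in> edge k j \<Longrightarrow> j = Suc i \<and> z = vertex k j"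
proof (induction k arbitrary: i j z)
  case 0
  then show ?case by simp
next
  case (Suc k)
  have i: "i < 2 ^ Suc k" using Suc.prems by simp
  from Suc.prems(2) show ?case
  proof (cases rule: edge_cases)
    case 1
    then have "edge (Suc k) i = gL ` edge k i" using Suc.prems edge_left by simp
    then obtain x where "x \<in> edge k i" "x \<in> edge k j" "z = gL x"
      using 1 Suc.prems inj_gL by (metis imageE)
    then show ?thesis using Suc.IH[of i j x] Suc.prems 1 by (simp add: vertex_left)
  next
    case j: (2 j')
    from i show ?thesis
    proof (cases rule: edge_cases)
      case 1
      obtain x y where xy: "x \<in> edge k i" "y \<in> edge k j'" "z = gL x" "z = gR y"
        using 1 j Suc.prems by auto
      moreover have "x \<in> T" "y \<in> T" using xy 1 j edge_subset_T by blast+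
      ultimately have "x = 1" "y = 0" using gL_eq_gR by auto
      then show ?thesis
        using last_in_edge[of i k] first_in_edge[of j' k] xy 1 j vertex_right[of k 0] by (simp add: gR_simps)
    next
      case (2 i')
      then obtain x where "x \<in> edge k i'" "x \<in> edge k j'" "z = gR x"
        using j Suc.prems inj_gR by (metis imageE)
      then have "j' = Suc i'" "x = vertex k j'" "z = gR x"
        using Suc.IH[of i' j' x] Suc.prems 2 j by auto
      then show ?thesis using 2 j vertex_right[of k j'] by simp
    qed
  qed
qed

end

section \<open>Transfer to chains in \<open>real^2\<close>\<close>

definition to_plane :: "complex \<Rightarrow> real^2" where "to_plane z = vector [Re z, Im z]"

lemma linear_to_plane: "linear to_plane"
  by (rule linearI) (auto simp: to_plane_def vec_eq_iff forall_2)

lemma dist_to_plane: "dist (to_plane x) (to_plane y) = dist x y"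
  by (simp add: to_plane_def dist_vec_def L2_set_def sum_2 dist_complex_def cmod_def dist_real_def)

lemma inj_to_plane: "to_plane x = to_plane y \<Longrightarrow> x = y"
  by (metis dist_eq_0_iff dist_to_plane)

context koch
begin

text \<open>The chain \<open>P\<^sup>m\<close> of the theorem is \<open>chain (2 * m)\<close>.\<close>
definition chain :: "nat \<Rightarrow> chain" where
  "chain k = map (\<lambda>i. to_plane (vertex k i)) [0..<2 ^ k + 1]"

lemma length_chain: "length (chain k) = 2 ^ k + 1"
  by (simp add: chain_def)

lemma chain_nth: "i \<le> 2 ^ k \<Longrightarrow> chain k ! i = to_plane (vertex k i)"
  unfolding chain_def by (subst nth_map) (auto simp del: upt_Suc)

lemma chain_edge_chain: "i < 2 ^ k \<Longrightarrow> chain_edge (chain k) i = to_plane ` edge k i"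
  by (simp add: chain_edge_def edge_def chain_nth closed_segment_linear_image linear_to_plane)

lemma simple_chain_chain: "simple_chain (chain k)"
  unfolding simple_chain_def
proof (intro conjI allI impI)
  fix i assume "Suc i < length (chain k)"
  then have i: "i < 2 ^ k" by (simp add: length_chain)
  then have "dist (vertex k i) (vertex k (Suc i)) \<noteq> 0"
    using cmod_Q(2) by (simp add: dist_vertex_Suc)
  then show "chain k ! i \<noteq> chain k ! Suc i"
    using i inj_to_plane by (auto simp: chain_nth)
next
  fix i assume "Suc (Suc i) < length (chain k)"
  then have i: "Suc i < 2 ^ k" by (simp add: length_chain)
  have "edge k i \<inter> edge k (Suc i) = {vertex k (Suc i)}"
    using i edges_meet[of i "Suc i" k] by (auto simp: edge_def)
  then show "chain_edge (chain k) i \<inter> chain_edge (chain k) (Suc i) = {chain k ! Suc i}"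
    using i inj_to_plane
    by (simp add: chain_edge_chain chain_nth image_Int[OF injI, symmetric])
next
  fix i j assume "Suc i < j \<and> Suc j < length (chain k)"
  then have ij: "Suc i < j" "j < 2 ^ k" by (auto simp: length_chain)
  then have "edge k i \<inter> edge k j = {}"
    using edges_meet[of i j k] by auto
  then show "chain_edge (chain k) i \<inter> chain_edge (chain k) j = {}"
    using ij inj_to_plane by (simp add: chain_edge_chain image_Int[OF injI, symmetric])
qed

lemma c_chain_chain: "c_chain (2 / (1 - 2 * a)) (chain k)"
  unfolding c_chain_def
proof (intro allI impI)
  fix i j l assume "i < j \<and> j < l \<and> l < length (chain k)"
  then have "i < j" "j < l" "l \<le> 2 ^ k" by (auto simp: length_chain)
  then show "dist (chain k ! i) (chain k ! j) + dist (chain k ! j) (chain k ! l)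
      \<le> 2 / (1 - 2 * a) * dist (chain k ! i) (chain k ! l)"
    using vertex_chain[of i j l k] a_bounds
    by (simp add: chain_nth dist_to_plane pos_le_divide_eq mult.commute)
qed

text \<open>There are \<open>2 ^ k\<close> edges of length \<open>cmod Q ^ k\<close>, and the ends
  \<open>0\<close> and \<open>1\<close> have distance 1.\<close>

lemma stretch_factor_chain: "stretch_factor (chain k) = 2 ^ k * cmod Q ^ k"
proof -
  have "hd (chain k) = to_plane 0"
    using chain_nth[of 0 k] length_chain[of k] by (subst hd_conv_nth) auto
  moreover have "last (chain k) = to_plane 1"
    using chain_nth[of "2 ^ k" k] length_chain[of k] by (subst last_conv_nth) auto
  moreover have "(\<Sum>i<length (chain k) - 1. dist (chain k ! i) (chain k ! Suc i)) = 2 ^ k * cmod Q ^ k"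
    by (simp add: length_chain chain_nth dist_to_plane dist_vertex_Suc)
  ultimately show ?thesis
    by (simp add: stretch_factor_def dist_to_plane)
qed

end

section \<open>Choice of the apex for a given \<open>c\<close>\<close>

theorem theorem4:
  fixes c :: real
  assumes "c \<ge> 4"
  shows "\<exists>P :: nat \<Rightarrow> chain. \<forall>m.
           simple_chain (P m) \<and> c_chain c (P m) \<and>
           length (P m) = 4 ^ m + 1 \<and>
           stretch_factor (P m) =
             real (length (P m) - 1) powr ((1 + log 2 (c - 2) - log 2 c) / 2)"
proof -
  \<comment> \<open>The height solves \<open>1/4 + (Im Q)\<^sup>2 = (c - 2) / (2 * c)\<close>, the
    value of \<open>a\<close> with \<open>2 / (1 - 2 * a) = c\<close>. For \<open>c = 4\<close> it
    is 0 and the chains are straight.\<close>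
  define Q where "Q = Complex (1/2) (sqrt ((c - 2) / (2 * c) - 1/4))"
  have "(c - 2) / (2 * c) \<ge> 1/4" using assms by (simp add: field_simps)
  then have Q2: "(cmod Q)\<^sup>2 = (c - 2) / (2 * c)"
    unfolding cmod_power2 by (simp add: Q_def power_divide)
  interpret koch Q
  proof
    show "Re Q = 1/2" by (simp add: Q_def)
    show "(cmod Q)\<^sup>2 < 1/2" unfolding Q2 using assms by (simp add: field_simps)
  qed
  have c: "2 / (1 - 2 * a) = c"
    unfolding a_def Q2 using assms by (simp add: field_simps)
  have four: "(4::'a::comm_semiring_1) ^ m = 2 ^ (2 * m)" for m by (simp add: power_mult)
  have "stretch_factor (chain (2 * m)) =
          real (4 ^ m) powr ((1 + log 2 (c - 2) - log 2 c) / 2)" for m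
  proof -
    let ?e = "(1 + log 2 (c - 2) - log 2 c) / 2"
    \<comment> \<open>The exponent is chosen so that \<open>4 powr ?e\<close> equals
      \<open>4 * a\<close>, the factor by which the length grows when \<open>m\<close> increases by
      one.\<close>
    have "2 * ?e = log 2 (2 * ((c - 2) / c))"
      using assms by (subst log_mult) (auto simp: log_divide)
    moreover have "2 powr log 2 (2 * ((c - 2) / c)) = 2 * ((c - 2) / c)"
      using assms by (intro powr_log_cancel) auto
    moreover have "2 powr (2 * ?e) = (2 powr 2) powr ?e"
      by (rule powr_powr[symmetric])
    ultimately have "(2 powr 2) powr ?e = 2 * ((c - 2) / c)"
      by metis
    then have "4 powr ?e = 2 * ((c - 2) / c)"
      by simp
    also have "\<dots> = 4 * (cmod Q)\<^sup>2"
      unfolding Q2 using assms by (simp add: field_simps)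
    finally have "4 powr ?e = 4 * (cmod Q)\<^sup>2" .
    then have "(4 powr ?e) ^ m = 2 ^ (2 * m) * cmod Q ^ (2 * m)"
      by (simp add: power_mult_distrib power_mult)
    moreover have "real (4 ^ m) powr ?e = (4 powr ?e) ^ m"
      using powr_powr_swap[of 4 "real m" ?e] by (simp add: powr_realpow)
    ultimately show ?thesis
      by (simp only: stretch_factor_chain)
  qed
  then show ?thesis
    using simple_chain_chain c_chain_chain length_chain c
    by (intro exI[of _ "\<lambda>m. chain (2 * m)"]) (simp add: four)
qed

end
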